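(* Let $k, r, d_1,\dots,d_k$ be positive integers, let $A\in\mathbb{R}^{d_1\times\dots\times d_k}$ be a nonnegative tensor (all entries are $\ge 0$), and let $\lVert\cdot\rVert:\mathbb{R}^{d_1\times\dots\times d_k}\to[0,\infty)$ be an arbitrary norm. Then the infimum $$\inf\Bigl\{\Bigl\lVert A-\sum_{p=1}^{r}\delta_p\,\mathbf{u}_p\otimes\mathbf{v}_p\otimes\dots\otimes\mathbf{z}_p\Bigr\rVert \Bigm| \boldsymbol{\delta}=(\delta_1,\dots,\delta_r)\in\mathbb{R}_+^r,\ \mathbf{u}_p\in\Delta^{d_1-1},\ \mathbf{v}_p\in\Delta^{d_2-1},\dots,\ \mathbf{z}_p\in\Delta^{d_k-1},\ p=1,\dots,r\Bigr\}$$ is attained.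
   Context: A tensor is a hypermatrix $A=(a_{j_1\cdots j_k})\in\mathbb{R}^{d_1\times\dots\times d_k}$, $1\le j_i\le d_i$; norms are norms on this real vector space of dimension $d_1\cdots d_k$. There are $k$ vectors in each list $\mathbf{u}_p,\mathbf{v}_p,\dots,\mathbf{z}_p$, the $i$-th one lying in $\mathbb{R}^{d_i}$. The outer product $\mathbf{u}\otimes\mathbf{v}\otimes\dots\otimes\mathbf{z}$ is the tensor with $(j_1,\dots,j_k)$ entry $u_{j_1}v_{j_2}\cdots z_{j_k}$. $\mathbb{R}_+^n=\{\mathbf{x}\in\mathbb{R}^n\mid \mathbf{x}\ge 0 \text{ entrywise}\}$ and $\Delta^{n-1}=\{\mathbf{x}\in\mathbb{R}_+^n\mid \lVert\mathbf{x}\rVert_1=1\}$ is the unit simplex. *)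

theory Defs
  imports Complex_Main "HOL-Library.FuncSet"
begin

text \<open>
  Coordinate spaces are indexed by an explicit finite set \<open>I\<close>: an element of \<open>\<real>^I\<close> is a function that
  vanishes outside \<open>I\<close>, so that vectors correspond one-to-one to such functions and the pointwise
  operations never leave the space.  \<open>\<real>^n\<close> is the case \<open>I = {..<n}\<close>, with coordinates counted from 0.
\<close>

definition coord_space :: "'a set \<Rightarrow> ('a \<Rightarrow> real) set" where
  "coord_space I = {x. \<forall>j. j \<notin> I \<longrightarrow> x j = 0}"

definition nonneg_orthant :: "'a set \<Rightarrow> ('a \<Rightarrow> real) set" where
  "nonneg_orthant I = {x \<in> coord_space I. \<forall>j\<in>I. 0 \<le> x j}"

definition l1_norm :: "'a set \<Rightarrow> ('a \<Rightarrow> real) \<Rightarrow> real" where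
  "l1_norm I x = (\<Sum>j\<in>I. \<bar>x j\<bar>)"

text \<open>\<open>unit_simplex n\<close> is the simplex of dimension \<open>n - 1\<close>, a subset of \<open>\<real>^n\<close>.\<close>

definition unit_simplex :: "nat \<Rightarrow> (nat \<Rightarrow> real) set" where
  "unit_simplex n = {x \<in> nonneg_orthant {..<n}. l1_norm {..<n} x = 1}"

text \<open>The values of \<open>N\<close> outside \<open>coord_space I\<close> are unconstrained.\<close>

definition norm_on_coord_space :: "'a set \<Rightarrow> (('a \<Rightarrow> real) \<Rightarrow> real) \<Rightarrow> bool" where
  "norm_on_coord_space I N \<longleftrightarrow>
     (\<forall>x\<in>coord_space I. 0 \<le> N x) \<and>
     (\<forall>x\<in>coord_space I. N x = 0 \<longleftrightarrow> x = (\<lambda>_. 0)) \<and>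
     (\<forall>c. \<forall>x\<in>coord_space I. N (\<lambda>j. c * x j) = \<bar>c\<bar> * N x) \<and>
     (\<forall>x\<in>coord_space I. \<forall>y\<in>coord_space I. N (\<lambda>j. x j + y j) \<le> N x + N y)"

text \<open>
  A multi-index \<open>(j\<^sub>1, \<dots>, j\<^sub>k)\<close> is a function on \<open>{..<k}\<close>; tensors of format \<open>d 0 \<times> \<dots> \<times> d (k - 1)\<close> are the
  elements of \<open>coord_space (multi_indices k d)\<close>.
\<close>

definition multi_indices :: "nat \<Rightarrow> (nat \<Rightarrow> nat) \<Rightarrow> (nat \<Rightarrow> nat) set" where
  "multi_indices k d = (\<Pi>\<^sub>E i\<in>{..<k}. {..<d i})"

definition outer_product ::
  "nat \<Rightarrow> (nat \<Rightarrow> nat) \<Rightarrow> (nat \<Rightarrow> nat \<Rightarrow> real) \<Rightarrow> (nat \<Rightarrow> nat) \<Rightarrow> real" where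
  "outer_product k d u = (\<lambda>j. if j \<in> multi_indices k d then \<Prod>i<k. u i (j i) else 0)"

end

theory Submission
  imports Defs "HOL-Analysis.Analysis"
begin

text \<open>
  The parameters range over a product of an orthant and finitely many simplices, and only the
  orthant of the weights \<open>\<delta>\<close> is unbounded.  The point is that nonnegativity forbids the cancellation
  that can make best low-rank approximations of signed tensors fail to exist: an outer product
  of points of simplices is a nonnegative tensor with entries summing to 1
  (\<open>l1_norm_outer_product\<close>), so the tensor
  \<open>\<Sum>\<^sub>p \<delta>\<^sub>p u\<^sub>p \<otimes> \<dots> \<otimes> z\<^sub>p\<close> has \<open>\<ell>\<^sub>1\<close>-norm exactly \<open>\<Sum>\<^sub>p \<delta>\<^sub>p\<close> (\<open>l1_norm_simplex_combination\<close>).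

  All norms on a finite-dimensional space are equivalent, so \<open>c * l1_norm x \<le> N x\<close> for some
  \<open>c > 0\<close> (\<open>l1_norm_le_norm\<close>).  A weight vector with \<open>\<Sum>\<^sub>p \<delta>\<^sub>p > 2 * N A / c\<close> thus gives a
  tensor at distance more than \<open>N A\<close> from \<open>A\<close>, which is worse than \<open>\<delta> = 0\<close>.  What remains is a compact
  set of parameters, on which the continuous distance attains its minimum.
\<close>

section \<open>Compactness and norms in finite-dimensional coordinate spaces\<close>

text \<open>
  The topology on functions is that of pointwise convergence.  Requiring the coordinates outside
  \<open>I\<close> to vanish makes the ball a closed subset of a product of compact sets, to which Tychonoff's
  theorem applies even though the index type is infinite.
\<close>

lemma compact_l1_ball:
  fixes I :: "'a set"
  assumes "finite I"
  shows "compact {x \<in> coord_space I. l1_norm I x \<le> R}"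
proof -
  define C where "C i = (if i \<in> I then {-R..R} else {0})" for i
  have "compactin (product_topology (\<lambda>_. euclidean) UNIV) (PiE UNIV C)"
    unfolding compactin_PiE by (auto simp: C_def)
  then have "compact (PiE UNIV C)"
    by (simp add: euclidean_product_topology)
  moreover have "closed {x. l1_norm I x \<le> R}"
    unfolding l1_norm_def
    by (intro closed_Collect_le continuous_intros) simp
  moreover have "{x \<in> coord_space I. l1_norm I x \<le> R} = PiE UNIV C \<inter> {x. l1_norm I x \<le> R}"
  proof -
    have "\<bar>x j\<bar> \<le> R" if "l1_norm I x \<le> R" "j \<in> I" for x j
      using member_le_sum[of j I "\<lambda>j. \<bar>x j\<bar>"] that assms by (simp add: l1_norm_def)
    then show ?thesis
      by (fastforce simp: C_def coord_space_def PiE_iff abs_le_iff split: if_splits)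
  qed
  ultimately show ?thesis
    by (simp add: compact_Int_closed)
qed

lemma coord_space_diff: "x \<in> coord_space I \<Longrightarrow> y \<in> coord_space I \<Longrightarrow> (\<lambda>j. x j - y j) \<in> coord_space I"
  by (simp add: coord_space_def)

lemma norm_triangle:
  assumes "norm_on_coord_space I N" "x \<in> coord_space I" "y \<in> coord_space I"
  shows "N (\<lambda>j. x j + y j) \<le> N x + N y"
  using assms by (simp add: norm_on_coord_space_def)

lemma norm_scale:
  assumes "norm_on_coord_space I N" "x \<in> coord_space I"
  shows "N (\<lambda>j. c * x j) = \<bar>c\<bar> * N x"
  using assms by (simp add: norm_on_coord_space_def)

lemma l1_norm_nonneg: "0 \<le> l1_norm I x"
  by (simp add: l1_norm_def sum_nonneg)

lemma norm_diff_le: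
  assumes "norm_on_coord_space I N" "x \<in> coord_space I" "y \<in> coord_space I"
  shows "N x - N y \<le> N (\<lambda>j. x j - y j)"
proof -
  have "N (\<lambda>j. (x j - y j) + y j) \<le> N (\<lambda>j. x j - y j) + N y"
    by (rule norm_triangle[OF assms(1) coord_space_diff[OF assms(2,3)] assms(3)])
  then show ?thesis by simp
qed

lemma norm_diff_commute:
  assumes "norm_on_coord_space I N" "x \<in> coord_space I" "y \<in> coord_space I"
  shows "N (\<lambda>j. x j - y j) = N (\<lambda>j. y j - x j)"
proof -
  have "N (\<lambda>j. (-1) * (y j - x j)) = \<bar>-1\<bar> * N (\<lambda>j. y j - x j)"
    by (rule norm_scale[OF assms(1) coord_space_diff[OF assms(3,2)]])
  then show ?thesis by simp
qed

text \<open>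
  Expanding \<open>x\<close> in the standard basis bounds \<open>N\<close> by the coordinates; applied to differences, this
  makes \<open>N\<close> continuous for pointwise convergence.
\<close>

lemma norm_le_weighted_sum:
  assumes "norm_on_coord_space I N" "finite I" "x \<in> coord_space I"
  shows "N x \<le> (\<Sum>i\<in>I. \<bar>x i\<bar> * N (\<lambda>j. if j = i then 1 else 0))"
proof -
  define e :: "'a \<Rightarrow> 'a \<Rightarrow> real" where "e i = (\<lambda>j. if j = i then 1 else 0)" for i
  have "N (\<lambda>j. \<Sum>i\<in>J. x i * e i j) \<le> (\<Sum>i\<in>J. \<bar>x i\<bar> * N (e i))" if "finite J" "J \<subseteq> I" for J
    using that
  proof (induction rule: finite_induct)
    case empty
    have "(\<lambda>_. 0) \<in> coord_space I"
      by (simp add: coord_space_def)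
    then show ?case
      using assms(1) unfolding norm_on_coord_space_def by auto
  next
    case (insert i J)
    have e: "e i \<in> coord_space I" and xe: "(\<lambda>j. x i * e i j) \<in> coord_space I"
      using insert.prems by (auto simp: coord_space_def e_def)
    have "(\<lambda>j. \<Sum>i\<in>J. x i * e i j) \<in> coord_space I"
      using insert.prems by (auto simp: coord_space_def e_def intro!: sum.neutral)
    then have "N (\<lambda>j. x i * e i j + (\<Sum>i\<in>J. x i * e i j))
        \<le> N (\<lambda>j. x i * e i j) + N (\<lambda>j. \<Sum>i\<in>J. x i * e i j)"
      by (rule norm_triangle[OF assms(1) xe])
    moreover have "N (\<lambda>j. x i * e i j) = \<bar>x i\<bar> * N (e i)"
      by (rule norm_scale[OF assms(1) e])
    ultimately show ?case
      using insert by simp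
  qed
  moreover have "(\<lambda>j. \<Sum>i\<in>I. x i * e i j) = x"
    using assms(2,3) by (auto simp: fun_eq_iff e_def coord_space_def if_distrib cong: if_cong)
  ultimately show ?thesis
    using assms(2) unfolding e_def by fastforce
qed

lemma continuous_on_norm_on_coord_space:
  fixes I :: "'a set" and f :: "'b::topological_space \<Rightarrow> 'a \<Rightarrow> real"
  assumes N: "norm_on_coord_space I N" and "finite I"
    and f: "\<And>z. z \<in> Z \<Longrightarrow> f z \<in> coord_space I"
    and cont: "\<And>i. i \<in> I \<Longrightarrow> continuous_on Z (\<lambda>z. f z i)"
  shows "continuous_on Z (\<lambda>z. N (f z))"
  unfolding continuous_on_def
proof
  fix a assume a: "a \<in> Z"
  define b where "b z = (\<Sum>i\<in>I. \<bar>f z i - f a i\<bar> * N (\<lambda>j. if j = i then 1 else 0))" for z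
  have "((\<lambda>z. f z i) \<longlongrightarrow> f a i) (at a within Z)" if "i \<in> I" for i
    using cont[OF that] a by (simp add: continuous_on_def)
  then have "(b \<longlongrightarrow> (\<Sum>i\<in>I. \<bar>f a i - f a i\<bar> * N (\<lambda>j. if j = i then 1 else 0))) (at a within Z)"
    unfolding b_def by (intro tendsto_intros)
  then have b0: "(b \<longlongrightarrow> 0) (at a within Z)"
    by simp
  have bound: "\<bar>N (f z) - N (f a)\<bar> \<le> b z" if "z \<in> Z" for z
  proof -
    have "N (\<lambda>j. f z j - f a j) \<le> b z"
      unfolding b_def
      by (rule norm_le_weighted_sum[OF N \<open>finite I\<close> coord_space_diff[OF f[OF that] f[OF a]]])
    then show ?thesis
      using norm_diff_le[OF N f[OF that] f[OF a]] norm_diff_le[OF N f[OF a] f[OF that]]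
        norm_diff_commute[OF N f[OF that] f[OF a]] by linarith
  qed
  have "((\<lambda>z. N (f z) - N (f a)) \<longlongrightarrow> 0) (at a within Z)"
  proof (rule Lim_null_comparison[OF _ b0])
    show "\<forall>\<^sub>F z in at a within Z. norm (N (f z) - N (f a)) \<le> b z"
      using bound by (auto simp: eventually_at_filter)
  qed
  then show "((\<lambda>z. N (f z)) \<longlongrightarrow> N (f a)) (at a within Z)"
    using LIM_zero_iff by blast
qed

text \<open>
  The constant is the minimum of \<open>N\<close> on the \<open>\<ell>\<^sub>1\<close>-sphere, which is positive because \<open>N\<close> vanishes
  only at the origin.
\<close>

lemma l1_norm_le_norm:
  assumes N: "norm_on_coord_space I N" and "finite I"
  obtains c where "0 < c" and "\<And>x. x \<in> coord_space I \<Longrightarrow> c * l1_norm I x \<le> N x"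
proof -
  define K where "K = {x \<in> coord_space I. l1_norm I x = 1}"
  have normalize: "(\<lambda>j. (1 / l1_norm I x) * x j) \<in> K"
    if "x \<in> coord_space I" "l1_norm I x \<noteq> 0" for x
  proof -
    have "0 < l1_norm I x"
      using that(2) l1_norm_nonneg[of I x] by linarith
    moreover have "l1_norm I (\<lambda>j. c * x j) = \<bar>c\<bar> * l1_norm I x" for c
      by (simp add: l1_norm_def abs_mult sum_distrib_left)
    ultimately have "l1_norm I (\<lambda>j. (1 / l1_norm I x) * x j) = 1"
      by (metis abs_of_pos divide_pos_pos nonzero_eq_divide_eq that(2) zero_less_one)
    then show ?thesis
      using that(1) by (simp add: K_def coord_space_def)
  qed
  have scale: "N (\<lambda>j. (1 / l1_norm I x) * x j) = N x / l1_norm I x" if "x \<in> coord_space I" for x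
    using norm_scale[OF N that, of "1 / l1_norm I x"] l1_norm_nonneg[of I x] by simp
  have Nnonneg: "0 \<le> N x" if "x \<in> coord_space I" for x
    using N that unfolding norm_on_coord_space_def by blast
  have "closed {x. l1_norm I x = 1}"
    unfolding l1_norm_def by (intro closed_Collect_eq continuous_intros) simp
  then have "compact ({x \<in> coord_space I. l1_norm I x \<le> 1} \<inter> {x. l1_norm I x = 1})"
    by (intro compact_Int_closed compact_l1_ball \<open>finite I\<close>)
  moreover have "{x \<in> coord_space I. l1_norm I x \<le> 1} \<inter> {x. l1_norm I x = 1} = K"
    by (auto simp: K_def)
  ultimately have "compact K"
    by simp
  moreover have "continuous_on K N"
    using continuous_on_norm_on_coord_space[OF N \<open>finite I\<close>, of K "\<lambda>x. x"]
    by (auto simp: K_def intro: continuous_on_subset[OF continuous_on_product_coordinates])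
  moreover have "\<exists>c>0. \<forall>x\<in>K. c \<le> N x"
  proof (cases "K = {}")
    case True
    \<comment> \<open>The sphere is empty when \<open>I\<close> is.\<close>
    then show ?thesis by (auto intro: exI[of _ 1])
  next
    case False
    then obtain y where y: "y \<in> K" "\<forall>x\<in>K. N y \<le> N x"
      using continuous_attains_inf[OF \<open>compact K\<close> _ \<open>continuous_on K N\<close>] by blast
    have "y \<noteq> (\<lambda>_. 0)" "y \<in> coord_space I"
      using y(1) by (auto simp: K_def l1_norm_def)
    then have "0 < N y"
      using N Nnonneg[of y] unfolding norm_on_coord_space_def by (metis less_eq_real_def)
    then show ?thesis
      using y(2) by blast
  qed
  then obtain c where c: "0 < c" "\<And>x. x \<in> K \<Longrightarrow> c \<le> N x"
    by blast
  show thesis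
  proof (rule that[OF c(1)])
    fix x assume x: "x \<in> coord_space I"
    show "c * l1_norm I x \<le> N x"
    proof (cases "l1_norm I x = 0")
      case True
      then show ?thesis using Nnonneg[OF x] by simp
    next
      case False
      then have "0 < l1_norm I x"
        using l1_norm_nonneg[of I x] by linarith
      then show ?thesis
        using c(2)[OF normalize[OF x False]] unfolding scale[OF x] by (simp add: le_divide_eq)
    qed
  qed
qed

section \<open>Simplices and nonnegative combinations of their outer products\<close>

lemma closed_nonneg: "closed {x :: 'a \<Rightarrow> real. \<forall>j\<in>I. 0 \<le> x j}"
proof -
  have "closed (\<Inter>j\<in>I. {x :: 'a \<Rightarrow> real. 0 \<le> x j})"
    by (intro closed_INT ballI closed_Collect_le continuous_intros) simp
  moreover have "(\<Inter>j\<in>I. {x :: 'a \<Rightarrow> real. 0 \<le> x j}) = {x. \<forall>j\<in>I. 0 \<le> x j}"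
    by blast
  ultimately show ?thesis by simp
qed

lemma compact_nonneg_l1_ball:
  assumes "finite I"
  shows "compact {x \<in> nonneg_orthant I. l1_norm I x \<le> R}"
proof -
  have "{x \<in> nonneg_orthant I. l1_norm I x \<le> R} =
      {x \<in> coord_space I. l1_norm I x \<le> R} \<inter> {x. \<forall>j\<in>I. 0 \<le> x j}"
    by (auto simp: nonneg_orthant_def)
  then show ?thesis
    using compact_Int_closed[OF compact_l1_ball[OF assms] closed_nonneg] by simp
qed

lemma compact_unit_simplex: "compact (unit_simplex n)"
proof -
  have "closed {x :: nat \<Rightarrow> real. l1_norm {..<n} x = 1}"
    unfolding l1_norm_def by (intro closed_Collect_eq continuous_intros) simp
  moreover have "unit_simplex n =
      {x \<in> nonneg_orthant {..<n}. l1_norm {..<n} x \<le> 1} \<inter> {x. l1_norm {..<n} x = 1}"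
    by (auto simp: unit_simplex_def)
  ultimately show ?thesis
    using compact_nonneg_l1_ball[of "{..<n}"] by (simp add: compact_Int_closed)
qed

lemma vertex_in_unit_simplex:
  assumes "0 < n"
  shows "(\<lambda>j. if j = 0 then 1 else 0) \<in> unit_simplex n"
  using assms
  by (auto simp: unit_simplex_def nonneg_orthant_def coord_space_def l1_norm_def if_distrib
      cong: if_cong)

lemma finite_multi_indices: "finite (multi_indices k d)"
  by (simp add: multi_indices_def finite_PiE)

lemma outer_product_in_nonneg_orthant:
  assumes "\<And>i. i < k \<Longrightarrow> u i \<in> unit_simplex (d i)"
  shows "outer_product k d u \<in> nonneg_orthant (multi_indices k d)"
proof -
  have "0 \<le> u i (j i)" if "j \<in> multi_indices k d" "i < k" for i j
    using assms[OF that(2)] that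
    by (auto simp: unit_simplex_def nonneg_orthant_def multi_indices_def PiE_iff)
  then show ?thesis
    by (auto simp: nonneg_orthant_def coord_space_def outer_product_def intro!: prod_nonneg)
qed

text \<open>The sum of the entries factors as a product of the coordinate sums of the factors.\<close>

lemma l1_norm_outer_product:
  assumes u: "\<And>i. i < k \<Longrightarrow> u i \<in> unit_simplex (d i)"
  shows "l1_norm (multi_indices k d) (outer_product k d u) = 1"
proof -
  have sum1: "(\<Sum>m<d i. u i m) = 1" if "i < k" for i
  proof -
    have "(\<Sum>m<d i. u i m) = l1_norm {..<d i} (u i)"
      using u[OF that] unfolding l1_norm_def
      by (intro sum.cong) (auto simp: unit_simplex_def nonneg_orthant_def)
    then show ?thesis
      using u[OF that] by (simp add: unit_simplex_def)
  qed
  have "l1_norm (multi_indices k d) (outer_product k d u)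
      = (\<Sum>j\<in>multi_indices k d. \<Prod>i<k. u i (j i))"
    using outer_product_in_nonneg_orthant[OF u]
    unfolding l1_norm_def by (intro sum.cong) (auto simp: nonneg_orthant_def outer_product_def)
  also have "\<dots> = (\<Prod>i<k. \<Sum>m<d i. u i m)"
    unfolding multi_indices_def by (rule prod_sum_PiE[symmetric]) auto
  also have "\<dots> = 1"
    using sum1 by simp
  finally show ?thesis .
qed

lemma simplex_combination_in_coord_space:
  "(\<lambda>j. \<Sum>p<r. \<delta> p * outer_product k d (u p) j) \<in> coord_space (multi_indices k d)"
  by (simp add: coord_space_def outer_product_def)

text \<open>On nonnegative tensors the \<open>\<ell>\<^sub>1\<close>-norm is the sum of the entries, so it is additive.\<close>

lemma l1_norm_simplex_combination:
  assumes \<delta>: "\<delta> \<in> nonneg_orthant {..<r}"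
    and u: "\<And>p i. p < r \<Longrightarrow> i < k \<Longrightarrow> u p i \<in> unit_simplex (d i)"
  shows "l1_norm (multi_indices k d) (\<lambda>j. \<Sum>p<r. \<delta> p * outer_product k d (u p) j)
    = l1_norm {..<r} \<delta>"
proof -
  let ?M = "multi_indices k d" and ?T = "\<lambda>p. outer_product k d (u p)"
  have \<delta>0: "0 \<le> \<delta> p" if "p < r" for p
    using \<delta> that by (simp add: nonneg_orthant_def)
  have T0: "0 \<le> ?T p j" if "p < r" "j \<in> ?M" for p j
    using outer_product_in_nonneg_orthant[OF u[OF that(1)]] that(2) by (simp add: nonneg_orthant_def)
  have "l1_norm ?M (\<lambda>j. \<Sum>p<r. \<delta> p * ?T p j) = (\<Sum>j\<in>?M. \<Sum>p<r. \<bar>\<delta> p\<bar> * \<bar>?T p j\<bar>)"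
    unfolding l1_norm_def
  proof (intro sum.cong refl)
    fix j assume "j \<in> ?M"
    then have "0 \<le> (\<Sum>p<r. \<delta> p * ?T p j)"
      using \<delta>0 T0 by (intro sum_nonneg mult_nonneg_nonneg) auto
    then show "\<bar>\<Sum>p<r. \<delta> p * ?T p j\<bar> = (\<Sum>p<r. \<bar>\<delta> p\<bar> * \<bar>?T p j\<bar>)"
      using \<delta>0 T0 \<open>j \<in> ?M\<close> by simp
  qed
  also have "\<dots> = (\<Sum>p<r. \<Sum>j\<in>?M. \<bar>\<delta> p\<bar> * \<bar>?T p j\<bar>)"
    by (rule sum.swap)
  also have "\<dots> = (\<Sum>p<r. \<bar>\<delta> p\<bar> * l1_norm ?M (?T p))"
    by (simp add: l1_norm_def sum_distrib_left)
  also have "\<dots> = l1_norm {..<r} \<delta>"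
    using l1_norm_outer_product[OF u] by (simp add: l1_norm_def)
  finally show ?thesis .
qed

section \<open>Existence of a best approximation\<close>

theorem corollary6p3:
  fixes k r :: nat and d :: "nat \<Rightarrow> nat"
    and A :: "(nat \<Rightarrow> nat) \<Rightarrow> real"
    and N :: "((nat \<Rightarrow> nat) \<Rightarrow> real) \<Rightarrow> real"
  assumes "0 < k" and "0 < r" and "\<And>i. i < k \<Longrightarrow> 0 < d i"
    and "A \<in> nonneg_orthant (multi_indices k d)"
    and "norm_on_coord_space (multi_indices k d) N"
  defines "S \<equiv> {N (\<lambda>j. A j - (\<Sum>p<r. \<delta> p * outer_product k d (u p) j)) | \<delta> u.
                 \<delta> \<in> nonneg_orthant {..<r} \<and> (\<forall>p<r. \<forall>i<k. u p i \<in> unit_simplex (d i))}"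
  shows "Inf S \<in> S"
proof -
  let ?M = "multi_indices k d"
  note N = \<open>norm_on_coord_space ?M N\<close>
  have A: "A \<in> coord_space ?M"
    using \<open>A \<in> nonneg_orthant ?M\<close> by (simp add: nonneg_orthant_def)
  define T :: "(nat \<Rightarrow> real) \<Rightarrow> (nat \<Rightarrow> nat \<Rightarrow> nat \<Rightarrow> real) \<Rightarrow> (nat \<Rightarrow> nat) \<Rightarrow> real"
    where "T \<delta> u = (\<lambda>j. \<Sum>p<r. \<delta> p * outer_product k d (u p) j)" for \<delta> u
  have T: "T \<delta> u \<in> coord_space ?M" for \<delta> u
    unfolding T_def by (rule simplex_combination_in_coord_space)
  define F where "F z = N (\<lambda>j. A j - T (fst z) (snd z) j)" for z
  obtain c where c: "0 < c" "\<And>x. x \<in> coord_space ?M \<Longrightarrow> c * l1_norm ?M x \<le> N x"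
    using l1_norm_le_norm[OF N finite_multi_indices] by blast
  have NA: "0 \<le> N A"
    using N A unfolding norm_on_coord_space_def by blast
  \<comment> \<open>Beyond \<open>R\<close> the tensor has norm above \<open>2 * N A\<close>, hence lies farther from \<open>A\<close> than 0 does.\<close>
  define R where "R = 2 * N A / c"

  \<comment> \<open>The factors \<open>u p i\<close> with \<open>p \<ge> r\<close> or \<open>i \<ge> k\<close> do not enter the tensor; confining them to a
    compact set as well makes the whole parameter space a product of compact sets.\<close>
  define C where "C i = (if i < k then unit_simplex (d i) else {\<lambda>_. 0})" for i
  define U where "U = PiE (UNIV :: nat set) (\<lambda>_. PiE UNIV C)"
  define D where "D = {\<delta> \<in> nonneg_orthant {..<r}. l1_norm {..<r} \<delta> \<le> R}"
  have "compactin (product_topology (\<lambda>_. euclidean) UNIV) (PiE UNIV C)"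
    unfolding compactin_PiE by (auto simp: C_def compact_unit_simplex)
  then have "compact (PiE UNIV C)"
    by (simp add: euclidean_product_topology)
  then have "compactin (product_topology (\<lambda>_. euclidean) UNIV) U"
    unfolding U_def compactin_PiE by auto
  then have "compact U"
    by (simp add: euclidean_product_topology)
  then have comp: "compact (D \<times> U)"
    unfolding D_def by (intro compact_Times compact_nonneg_l1_ball) auto
  have cont: "continuous_on (D \<times> U) F"
    unfolding F_def
  proof (rule continuous_on_norm_on_coord_space[OF N finite_multi_indices])
    show "(\<lambda>j. A j - T (fst z) (snd z) j) \<in> coord_space ?M" for z
      by (rule coord_space_diff[OF A T])
    have "continuous_on (D \<times> U) (\<lambda>z. fst z p)" for p
      by (rule continuous_on_product_then_coordinatewise) (intro continuous_intros)
    moreover have "continuous_on (D \<times> U) (\<lambda>z. snd z p i m)" for p i m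
      by (intro continuous_on_product_then_coordinatewise[where f = "\<lambda>z. snd z p i"]
          continuous_on_product_then_coordinatewise[where f = "\<lambda>z. snd z p"]
          continuous_on_product_then_coordinatewise[where f = snd] continuous_intros)
    ultimately show "continuous_on (D \<times> U) (\<lambda>z. A j - T (fst z) (snd z) j)" if "j \<in> ?M" for j
      using that unfolding T_def outer_product_def by (simp add: continuous_intros)
  qed
  have zeroD: "(\<lambda>_. 0) \<in> D"
    using NA c(1) by (simp add: D_def R_def nonneg_orthant_def coord_space_def l1_norm_def)
  define v :: "nat \<Rightarrow> nat \<Rightarrow> nat \<Rightarrow> real"
    where "v p i = (if i < k then \<lambda>j. if j = 0 then 1 else 0 else (\<lambda>_. 0))" for p i
  have "v \<in> U"
    using vertex_in_unit_simplex \<open>\<And>i. i < k \<Longrightarrow> 0 < d i\<close> by (auto simp: U_def C_def v_def PiE_iff)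
  then have "D \<times> U \<noteq> {}"
    using zeroD by blast
  from continuous_attains_inf[OF comp this cont] obtain \<delta>0 u0 where min: "\<delta>0 \<in> D" "u0 \<in> U"
    "\<And>\<delta> u. \<delta> \<in> D \<Longrightarrow> u \<in> U \<Longrightarrow> F (\<delta>0, u0) \<le> F (\<delta>, u)"
    by auto

  have small: "F (\<delta>0, u0) \<le> N A"
    using min(3)[OF zeroD \<open>v \<in> U\<close>] by (simp add: F_def T_def)
  have "F (\<delta>0, u0) \<le> F (\<delta>, u)"
    if \<delta>: "\<delta> \<in> nonneg_orthant {..<r}" and u: "\<forall>p<r. \<forall>i<k. u p i \<in> unit_simplex (d i)" for \<delta> u
  proof (cases "l1_norm {..<r} \<delta> \<le> R")
    case True
    \<comment> \<open>Filling the irrelevant factors from \<open>v\<close> moves \<open>u\<close> into \<open>U\<close> without changing its tensor.\<close>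
    define w where "w p i = (if p < r \<and> i < k then u p i else v p i)" for p i
    have "v p i \<in> C i" for p i
      using \<open>v \<in> U\<close> by (auto simp: U_def PiE_iff)
    then have "w \<in> U"
      using u by (simp add: U_def w_def PiE_iff) (simp add: C_def)
    moreover have "T \<delta> w = T \<delta> u"
      unfolding T_def outer_product_def
      by (intro ext sum.cong refl arg_cong2[where f = times] if_cong prod.cong) (auto simp: w_def)
    ultimately show ?thesis
      using min(3)[of \<delta> w] \<delta> True by (simp add: D_def F_def)
  next
    case False
    then have "2 * N A < c * l1_norm ?M (T \<delta> u)"
      using c(1) l1_norm_simplex_combination[OF \<delta>, of k u d] u
      by (simp add: R_def T_def not_le pos_divide_less_eq mult.commute)
    also have "\<dots> \<le> N (T \<delta> u)"
      by (rule c(2)[OF T])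
    also have "\<dots> \<le> N A + F (\<delta>, u)"
      using norm_diff_le[OF N T A, of \<delta> u] norm_diff_commute[OF N T A, of \<delta> u] by (simp add: F_def)
    finally show ?thesis
      using small by simp
  qed
  moreover have "F (\<delta>0, u0) \<in> S"
  proof -
    have "u0 p i \<in> unit_simplex (d i)" if "i < k" for p i
      using \<open>u0 \<in> U\<close> that by (auto simp: U_def C_def PiE_iff split: if_splits dest!: spec[of _ i] spec[of _ p])
    then show ?thesis
      using min(1) unfolding S_def F_def T_def D_def by auto
  qed
  ultimately have "Inf S = F (\<delta>0, u0)"
    by (intro cInf_eq_minimum) (auto simp: S_def F_def T_def)
  then show ?thesis
    using \<open>F (\<delta>0, u0) \<in> S\<close> by simp
qed

end
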